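(* Let $\mu$ be a stationary $\phi$-mixing probability measure on $(\mathcal X,\mathcal F)$, $\mathcal X=\mathcal A^{\mathbb N}$, such that $\mu(a)<1$ for every symbol $a\in\mathcal A$. Then: (a) $\rho(x_0^{n-1})\to 1$ as $n\to\infty$, for $\mu$-almost every $x\in\mathcal X$. (b) If $\mu$ is $\psi$-mixing, or if $\mu$ is summable $\phi$-mixing (that is, $\sum_n\phi(n)<\infty$), then there exists $n_1\ge1$ such that $$\rho_-:=\inf\left\{\rho(x_0^{n-1}):\ n\ge n_1,\ x_0^{n-1}\in\mathcal A^n,\ \mu(x_0^{n-1})>0\right\}>0.$$
   Context: $\mathcal A$ is a countable alphabet, $\mathbb N=\{0,1,2,\dots\}$, $\mathcal X=\mathcal A^{\mathbb N}$, $\mathcal F$ is the $\sigma$-algebra generated by cylinder sets, $\mathcal F_i^j$ is the $\sigma$-algebra generated by the coordinates with indices $i,\dots,j$ ($0\le i\le j\le\infty$), and $\sigma:\mathcal X\to\mathcal X$ is the left shift, $(\sigma x)_i=x_{i+1}$. Stationary means $\sigma$-invariant. A string $A=x_0^{n-1}=(x_0,\dots,x_{n-1})\in\mathcal A^n$ is identified with the cylinder $\{y\in\mathcal X:y_i=x_i,\ 0\le i\le n-1\}$. For $\mu(A)>0$, $\mu_A(\cdot)=\mu(\cdot\cap A)/\mu(A)$. Mixing: for $n\ge1$, $$\phi(n)=\sup_{i\in\mathbb N,\,A\in\mathcal F_0^i,\,B\in\mathcal F_{i+n}^\infty}\left|\frac{\mu(A\cap B)}{\mu(A)}-\mu(B)\right|,\qquad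 \psi(n)=\sup_{i\in\mathbb N,\,A\in\mathcal F_0^i,\,B\in\mathcal F_{i+n}^\infty}\left|\frac{\mu(A\cap B)}{\mu(A)\mu(B)}-1\right|$$ (suprema over sets for which the quotients are defined; $\psi(n)$ may be $+\infty$). $\mu$ is $\phi$-mixing (resp. $\psi$-mixing) if $\phi(n)\to0$ (resp. $\psi(n)\to0$) as $n\to\infty$. Recurrence: $T_A(y)=\inf\{k\ge1:\sigma^k(y)\in A\}$; $\tau(A)=\inf\{k\ge1:\mu_A(\sigma^{-k}(A))>0\}$ (shortest possible return); $\rho(A)=\mu_A(T_A>\tau(A))$ (potential well), defined for $\mu(A)>0$. *)

theory Defs
  imports "HOL-Probability.Probability"
begin

text \<open>
  The alphabet is a type of class \<open>countable\<close> (finite or countably infinite).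
\<close>

abbreviation seq_space :: "(nat \<Rightarrow> 'a::countable) measure" where
  "seq_space \<equiv> \<Pi>\<^sub>M i\<in>UNIV. count_space UNIV"

definition cylinder :: "'a list \<Rightarrow> (nat \<Rightarrow> 'a) set" where
  "cylinder w = {y. \<forall>i<length w. y i = w ! i}"

definition prefix_of :: "(nat \<Rightarrow> 'a) \<Rightarrow> nat \<Rightarrow> 'a list" where
  "prefix_of x n = map x [0..<n]"

definition shift :: "(nat \<Rightarrow> 'a) \<Rightarrow> nat \<Rightarrow> 'a" where
  "shift x = (\<lambda>i. x (Suc i))"

text \<open>
  \<open>coord_sets i j\<close> is the sigma-algebra generated by the coordinates \<open>i, \<dots>, j\<close>, with
  \<open>j = \<infinity>\<close> allowed; \<open>sets seq_space\<close> is \<open>coord_sets 0 \<infinity>\<close> and also the sigma-algebra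
  generated by the cylinders (proved below).
\<close>

definition coord_sets :: "nat \<Rightarrow> enat \<Rightarrow> (nat \<Rightarrow> 'a) set set" where
  "coord_sets i j =
     sigma_sets UNIV {{x. x k \<in> S} | k S. i \<le> k \<and> enat k \<le> j}"

definition stationary :: "(nat \<Rightarrow> 'a) measure \<Rightarrow> bool" where
  "stationary M \<longleftrightarrow> shift \<in> measurable M M \<and> distr M M shift = M"

text \<open>
  The mixing coefficients take extended values since \<open>\<psi>(n)\<close> may be infinite.
\<close>

definition phi_coeff :: "(nat \<Rightarrow> 'a) measure \<Rightarrow> nat \<Rightarrow> ennreal" where
  "phi_coeff M n =
     Sup {ennreal \<bar>measure M (A \<inter> B) / measure M A - measure M B\<bar> | i A B.
            A \<in> coord_sets 0 (enat i) \<and> B \<in> coord_sets (i + n) \<infinity> \<and> measure M A > 0}"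

definition psi_coeff :: "(nat \<Rightarrow> 'a) measure \<Rightarrow> nat \<Rightarrow> ennreal" where
  "psi_coeff M n =
     Sup {ennreal \<bar>measure M (A \<inter> B) / (measure M A * measure M B) - 1\<bar> | i A B.
            A \<in> coord_sets 0 (enat i) \<and> B \<in> coord_sets (i + n) \<infinity> \<and>
            measure M A > 0 \<and> measure M B > 0}"

definition phi_mixing :: "(nat \<Rightarrow> 'a) measure \<Rightarrow> bool" where
  "phi_mixing M \<longleftrightarrow> phi_coeff M \<longlonglongrightarrow> 0"

definition psi_mixing :: "(nat \<Rightarrow> 'a) measure \<Rightarrow> bool" where
  "psi_mixing M \<longleftrightarrow> psi_coeff M \<longlonglongrightarrow> 0"

text \<open>The coefficients are indexed by \<open>n \<ge> 1\<close>, hence the \<open>Suc\<close>.\<close>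

definition summable_phi_mixing :: "(nat \<Rightarrow> 'a) measure \<Rightarrow> bool" where
  "summable_phi_mixing M \<longleftrightarrow> phi_mixing M \<and> (\<Sum>n. phi_coeff M (Suc n)) < \<infinity>"

text \<open>
  Both infima below are taken in \<open>enat\<close>, so that the infimum of the empty set is \<open>\<infinity>\<close>.
  The conditional measure \<open>\<mu>\<^sub>A\<close> is \<open>uniform_measure M A\<close>.
\<close>

definition hitting_time :: "(nat \<Rightarrow> 'a) set \<Rightarrow> (nat \<Rightarrow> 'a) \<Rightarrow> enat" where
  "hitting_time A y = Inf (enat ` {k. 1 \<le> k \<and> (shift ^^ k) y \<in> A})"

definition shortest_return :: "(nat \<Rightarrow> 'a) measure \<Rightarrow> (nat \<Rightarrow> 'a) set \<Rightarrow> enat" where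
  "shortest_return M A =
     Inf (enat ` {k. 1 \<le> k \<and> measure (uniform_measure M A) ((shift ^^ k) -` A) > 0})"

definition potential_well :: "(nat \<Rightarrow> 'a) measure \<Rightarrow> (nat \<Rightarrow> 'a) set \<Rightarrow> real" where
  "potential_well M A =
     measure (uniform_measure M A) {y. hitting_time A y > shortest_return M A}"

lemma cylinder_in_sets: "cylinder w \<in> sets (seq_space :: (nat \<Rightarrow> 'a::countable) measure)"
proof -
  have "cylinder w = {y \<in> space seq_space. \<forall>i<length w. y i = w ! i}"
    by (auto simp: cylinder_def space_PiM)
  also have "\<dots> \<in> sets seq_space"
    by measurable
  finally show ?thesis .
qed

lemma coord_sets_eq_cylinders:
  "coord_sets 0 \<infinity> = sigma_sets UNIV (range (cylinder :: 'a::countable list \<Rightarrow> _))"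
  unfolding coord_sets_def
proof (rule sigma_sets_eqI)
  fix A :: "(nat \<Rightarrow> 'a) set"
  assume "A \<in> {{x. x k \<in> S} | k S. 0 \<le> k \<and> enat k \<le> \<infinity>}"
  then obtain k S where A: "A = {x. x k \<in> S}" by auto
  have "A = \<Union> (cylinder ` {w. length w = Suc k \<and> w ! k \<in> S})" (is "_ = ?U")
  proof
    show "A \<subseteq> ?U"
    proof
      fix x assume "x \<in> A"
      then have "x \<in> cylinder (map x [0..<Suc k])" "map x [0..<Suc k] ! k \<in> S"
        by (auto simp: A cylinder_def simp del: upt_Suc)
      then show "x \<in> ?U" by (auto simp del: upt_Suc intro!: exI[of _ "map x [0..<Suc k]"])
    qed
  qed (auto simp: A cylinder_def)
  also have "\<dots> \<in> sigma_sets UNIV (range cylinder)"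
  proof -
    interpret sigma_algebra UNIV "sigma_sets UNIV (range (cylinder :: 'a list \<Rightarrow> _))"
      by (rule sigma_algebra_sigma_sets) simp
    show ?thesis
      by (rule countable_UN') (auto intro: sigma_sets.Basic)
  qed
  finally show "A \<in> sigma_sets UNIV (range cylinder)" .
next
  fix A :: "(nat \<Rightarrow> 'a) set"
  assume "A \<in> range cylinder"
  then obtain w where A: "A = cylinder w" by auto
  interpret sigma_algebra UNIV
    "sigma_sets UNIV {{x :: nat \<Rightarrow> 'a. x k \<in> S} | k S. 0 \<le> k \<and> enat k \<le> \<infinity>}"
    by (rule sigma_algebra_sigma_sets) simp
  have 1: "{x. x i = w ! i} \<in> sigma_sets UNIV {{x. x k \<in> S} | k S. 0 \<le> k \<and> enat k \<le> \<infinity>}" for i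
    by (rule sigma_sets.Basic) (auto intro!: exI[of _ i] exI[of _ "{w ! i}"])
  show "A \<in> sigma_sets UNIV {{x. x k \<in> S} | k S. 0 \<le> k \<and> enat k \<le> \<infinity>}"
  proof (cases "w = []")
    case True
    then show ?thesis using top by (simp add: A cylinder_def)
  next
    case False
    then have "A = (\<Inter>i\<in>{..<length w}. {x. x i = w ! i})"
      by (auto simp: A cylinder_def)
    moreover have "\<dots> \<in> sigma_sets UNIV {{x. x k \<in> S} | k S. 0 \<le> k \<and> enat k \<le> \<infinity>}"
      by (rule finite_INT) (use False 1 in auto)
    ultimately show ?thesis by simp
  qed
qed

lemma sets_seq_space_eq_coord_sets:
  "sets (seq_space :: (nat \<Rightarrow> 'a::countable) measure) = coord_sets 0 \<infinity>"
  by (auto simp: sets_PiM_single coord_sets_def PiE_def intro!: arg_cong2[where f=sigma_sets])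

lemma sets_seq_space_eq_cylinders:
  "sets (seq_space :: (nat \<Rightarrow> 'a::countable) measure) = sigma_sets UNIV (range cylinder)"
  by (simp add: sets_seq_space_eq_coord_sets coord_sets_eq_cylinders)

lemma shift_measurable:
  "shift \<in> measurable seq_space (seq_space :: (nat \<Rightarrow> 'a::countable) measure)"
  unfolding shift_def by (rule measurable_PiM_single') (auto simp: space_PiM)

end

theory Submission
  imports Defs
begin

text \<open>
  If \<open>k\<close> is the shortest return time of \<open>A\<close>, the potential well is one minus the conditional
  probability of returning at time \<open>k\<close>.

  For (a), that probability is small as soon as both \<open>k\<close> and the length of the word are large, because
  measures of cylinders decay uniformly, and \<open>k\<close> tends to infinity along every nonperiodic point.

  For (b), let \<open>W\<^sub>j\<close> be the event of being in \<open>A\<close> at the times \<open>0, k, \<dots>, j k\<close>. By stationarity the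
  decrements \<open>\<mu>(W\<^sub>j) - \<mu>(W\<^sub>j\<^sub>+\<^sub>1)\<close> are nonincreasing, so a first decrement that is small relative
  to \<open>\<mu>(A)\<close> would keep \<open>\<mu>(W\<^sub>j)\<close> close to \<open>\<mu>(A)\<close>, whereas mixing makes it smaller by a fixed
  factor at some \<open>j\<close> independent of \<open>A\<close> and \<open>k\<close>.
\<close>

section \<open>Cylinders, iterated shifts and coordinate sigma-algebras\<close>

lemma shift_funpow: "(shift ^^ p) y i = y (p + i)"
  by (induction p arbitrary: i) (auto simp: shift_def)

lemma length_prefix_of [simp]: "length (prefix_of x n) = n"
  by (simp add: prefix_of_def)

lemma nth_prefix_of [simp]: "i < n \<Longrightarrow> prefix_of x n ! i = x i"
  by (simp add: prefix_of_def)

lemma cylinder_Nil [simp]: "cylinder [] = UNIV"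
  by (simp add: cylinder_def)

lemma in_cylinder_prefix_of: "x \<in> cylinder (prefix_of x n)"
  by (simp add: cylinder_def)

lemma cylinder_append: "cylinder (w @ v) = cylinder w \<inter> (shift ^^ length w) -` cylinder v"
proof -
  have "(\<forall>i<length (w @ v). y i = (w @ v) ! i) \<longleftrightarrow>
        (\<forall>i<length w. y i = w ! i) \<and> (\<forall>i<length v. y (length w + i) = v ! i)" (is "?L \<longleftrightarrow> ?R") for y
  proof
    assume L: ?L
    have "y i = w ! i" if "i < length w" for i
      using L[rule_format, of i] that by (simp add: nth_append)
    moreover have "y (length w + i) = v ! i" if "i < length v" for i
      using L[rule_format, of "length w + i"] that by (simp add: nth_append)
    ultimately show ?R by blast
  next
    assume R: ?R
    show ?L
    proof (intro allI impI)
      fix i assume "i < length (w @ v)"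
      then show "y i = (w @ v) ! i"
        using R[THEN conjunct1, rule_format, of i] R[THEN conjunct2, rule_format, of "i - length w"]
        by (cases "i < length w") (auto simp: nth_append)
    qed
  qed
  then show ?thesis
    by (auto simp: cylinder_def shift_funpow)
qed

lemma vimage_shift_cylinder_in_coord_sets:
  assumes "\<And>i. i < length v \<Longrightarrow> enat (p + i) \<le> j"
  shows "(shift ^^ p) -` cylinder v \<in> coord_sets p j"
proof -
  interpret sigma_algebra UNIV "coord_sets p j"
    unfolding coord_sets_def by (rule sigma_algebra_sigma_sets) simp
  have *: "{y. y (p + i) = v ! i} \<in> coord_sets p j" if "i < length v" for i
    unfolding coord_sets_def
    by (rule sigma_sets.Basic) (use assms[OF that] in \<open>auto intro!: exI[of _ "p + i"] exI[of _ "{v ! i}"]\<close>)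
  show ?thesis
  proof (cases "v = []")
    case True
    then show ?thesis using top by simp
  next
    case False
    then have "(shift ^^ p) -` cylinder v = (\<Inter>i\<in>{..<length v}. {y. y (p + i) = v ! i})"
      by (auto simp: cylinder_def shift_funpow)
    moreover have "\<dots> \<in> coord_sets p j"
      by (rule finite_INT) (use False * in auto)
    ultimately show ?thesis by simp
  qed
qed

lemma coord_sets_antimono_left: "i \<le> i' \<Longrightarrow> coord_sets i' j \<subseteq> coord_sets i j"
  unfolding coord_sets_def by (rule sigma_sets_subseteq) force

text \<open>A sequence of period \<open>k\<close> is determined by its first \<open>k\<close>
  symbols, and there are only countably many words.\<close>

lemma countable_periodic:
  assumes "k > 0"
  shows "countable {x :: nat \<Rightarrow> 'a::countable. \<forall>i. x (k + i) = x i}" (is "countable ?P")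
proof (rule countableI')
  show "inj_on (\<lambda>x. to_nat (prefix_of x k)) ?P"
  proof (rule inj_onI, rule ext)
    fix x y i
    assume x: "x \<in> ?P" and y: "y \<in> ?P" and "to_nat (prefix_of x k) = to_nat (prefix_of y k)"
    then have eq: "prefix_of x k = prefix_of y k" by simp
    show "x i = y i"
    proof (induction i rule: less_induct)
      case (less i)
      show ?case
      proof (cases "i < k")
        case True
        then show ?thesis using nth_prefix_of[of i k x] nth_prefix_of[of i k y] eq by simp
      next
        case False
        then have "x (i - k) = y (i - k)" using assms by (intro less) auto
        then show ?thesis
          using x y False by (auto dest!: spec[of _ "i - k"])
      qed
    qed
  qed
qed

section \<open>Stationarity and mixing on cylinders\<close>

locale phi_mixing_shift = prob_space \<mu> for \<mu> :: "(nat \<Rightarrow> 'a::countable) measure" +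
  assumes sets_mu [measurable_cong]: "sets \<mu> = sets seq_space"
    and stationary: "stationary \<mu>"
    and phi_mixing: "phi_mixing \<mu>"
    and symbol_less_1: "measure \<mu> (cylinder [a]) < 1"
begin

lemma space_mu [simp]: "space \<mu> = UNIV"
  using sets_eq_imp_space_eq[OF sets_mu] by (simp add: space_PiM)

lemma cylinder_sets [measurable]: "cylinder w \<in> sets \<mu>"
  using cylinder_in_sets sets_mu by blast

lemma shift_funpow_measurable [measurable]: "shift ^^ k \<in> measurable \<mu> \<mu>"
proof (induction k)
  case (Suc k)
  have "shift \<in> measurable \<mu> \<mu>" using stationary by (simp add: stationary_def)
  from measurable_comp[OF Suc this] show ?case by (simp add: comp_def)
qed (simp add: id_def)

lemma vimage_shift_sets [measurable]: "A \<in> sets \<mu> \<Longrightarrow> (shift ^^ k) -` A \<in> sets \<mu>"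
  using measurable_sets[OF shift_funpow_measurable] by simp

lemma prob_vimage_shift: "A \<in> sets \<mu> \<Longrightarrow> prob ((shift ^^ k) -` A) = prob A"
proof (induction k)
  case (Suc k)
  have "(shift ^^ Suc k) -` A = shift -` ((shift ^^ k) -` A)"
    by (simp only: funpow_Suc_right vimage_comp)
  also have "prob \<dots> = measure (distr \<mu> \<mu> shift) ((shift ^^ k) -` A)"
    using stationary Suc.prems by (subst measure_distr) (auto simp: stationary_def)
  also have "\<dots> = prob ((shift ^^ k) -` A)"
    using stationary by (simp add: stationary_def)
  finally show ?case using Suc by (simp only:)
qed simp

text \<open>The coefficient \<open>phi_coeff\<close> bounds a quotient; multiplying by
  \<open>prob (cylinder w)\<close> gives a form that also covers null cylinders. \<open>N\<close>
  depends on \<epsilon> only, which makes the bounds derived from it uniform in the words.\<close>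

lemma cylinder_mixing:
  assumes "\<epsilon> > 0"
  shows "\<exists>N. \<forall>w v p. length w + N \<le> p \<longrightarrow>
    \<bar>prob (cylinder w \<inter> (shift ^^ p) -` cylinder v) - prob (cylinder w) * prob (cylinder v)\<bar>
      \<le> \<epsilon> * prob (cylinder w)"
proof -
  have "\<forall>\<^sub>F g in sequentially. phi_coeff \<mu> g < ennreal \<epsilon>"
    using phi_mixing assms unfolding phi_mixing_def by (intro order_tendstoD(2)) auto
  then obtain N where N: "phi_coeff \<mu> N < ennreal \<epsilon>"
    by (auto simp: eventually_sequentially)
  show ?thesis
  proof (intro exI allI impI)
    fix w v :: "'a list" and p assume p: "length w + N \<le> p"
    let ?A = "cylinder w" and ?B = "(shift ^^ p) -` cylinder v"
    \<comment> \<open>The single coefficient at \<open>N\<close> serves every larger distance,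
      because the tail sigma-algebras decrease.\<close>
    have B: "?B \<in> coord_sets (length w + N) \<infinity>"
      using vimage_shift_cylinder_in_coord_sets[of v p \<infinity>] coord_sets_antimono_left[OF p] by auto
    \<comment> \<open>The last coordinate of \<open>w\<close> is \<open>length w - 1\<close>; the
      index \<open>length w\<close> also suits the empty word and matches the left end
      \<open>length w + N\<close> used for \<open>?B\<close>.\<close>
    have A: "?A \<in> coord_sets 0 (enat (length w))"
      using vimage_shift_cylinder_in_coord_sets[of w 0] by simp
    show "\<bar>prob (?A \<inter> ?B) - prob ?A * prob (cylinder v)\<bar> \<le> \<epsilon> * prob ?A"
    proof (cases "prob ?A = 0")
      case True
      then have "prob (?A \<inter> ?B) = 0"
        using finite_measure_mono[of "?A \<inter> ?B" ?A] by (auto intro: antisym)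
      then show ?thesis using True by simp
    next
      case False
      then have pos: "prob ?A > 0" by (simp add: zero_less_measure_iff)
      have "ennreal \<bar>prob (?A \<inter> ?B) / prob ?A - prob ?B\<bar> \<le> phi_coeff \<mu> N"
        unfolding phi_coeff_def by (rule Sup_upper) (use A B pos in blast)
      then have "ennreal \<bar>prob (?A \<inter> ?B) / prob ?A - prob ?B\<bar> < ennreal \<epsilon>"
        using N by (rule order.strict_trans1)
      then have "\<bar>prob (?A \<inter> ?B) / prob ?A - prob ?B\<bar> \<le> \<epsilon>"
        using assms by (simp add: ennreal_less_iff)
      then have "\<bar>prob (?A \<inter> ?B) / prob ?A - prob (cylinder v)\<bar> * prob ?A \<le> \<epsilon> * prob ?A"
        by (intro mult_right_mono) (auto simp: prob_vimage_shift)
      also have "\<bar>prob (?A \<inter> ?B) / prob ?A - prob (cylinder v)\<bar> * prob ?A =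
          \<bar>(prob (?A \<inter> ?B) / prob ?A - prob (cylinder v)) * prob ?A\<bar>"
        by (simp add: abs_mult)
      also have "(prob (?A \<inter> ?B) / prob ?A - prob (cylinder v)) * prob ?A =
          prob (?A \<inter> ?B) - prob ?A * prob (cylinder v)"
        using pos by (simp add: field_simps)
      finally show ?thesis .
    qed
  qed
qed

section \<open>Uniform decay of cylinder measures\<close>

lemma symbol_bound: "\<exists>s<1. \<forall>a. prob (cylinder [a]) \<le> s"
\<comment> \<open>The bound has to be uniform over a possibly infinite alphabet. A symbol of
  probability above 1/2 is the most likely one, since distinct symbols are disjoint events; if there
  is none, 1/2 serves.\<close>
proof (cases "\<exists>a. prob (cylinder [a]) > 1 / 2")
  case True
  then obtain a where a: "prob (cylinder [a]) > 1 / 2" by blast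
  have "prob (cylinder [b]) \<le> prob (cylinder [a])" for b
  proof (cases "b = a")
    case False
    then have "cylinder [a] \<inter> cylinder [b] = {}" by (auto simp: cylinder_def)
    then have "prob (cylinder [a]) + prob (cylinder [b]) = prob (cylinder [a] \<union> cylinder [b])"
      by (simp add: finite_measure_Union)
    also have "\<dots> \<le> 1" by (rule prob_le_1)
    finally show ?thesis using a by simp
  qed simp
  then show ?thesis using symbol_less_1 by blast
next
  case False
  then show ?thesis by (intro exI[of _ "1 / 2"]) (auto simp: not_less)
qed

text \<open>Up to the mixing error, a distant symbol has its unconditional probability, at most some
  \<open>s < 1\<close>. An error of \<open>(1 - s) / 2\<close> leaves the factor
  \<open>(1 + s) / 2\<close>, still below 1.\<close>

lemma far_symbol_bound:
  "\<exists>r N. 0 \<le> r \<and> r < 1 \<and> (\<forall>w p a. length w + N \<le> p \<longrightarrow>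
     prob (cylinder w \<inter> (shift ^^ p) -` cylinder [a]) \<le> r * prob (cylinder w))"
proof -
  obtain s where s: "s < 1" "\<And>a. prob (cylinder [a]) \<le> s" using symbol_bound by blast
  have "s \<ge> 0" using s(2) measure_nonneg order_trans by blast
  obtain N where N: "\<And>w v p. length w + N \<le> p \<Longrightarrow>
    \<bar>prob (cylinder w \<inter> (shift ^^ p) -` cylinder v) - prob (cylinder w) * prob (cylinder v)\<bar>
      \<le> (1 - s) / 2 * prob (cylinder w)"
    using cylinder_mixing[of "(1 - s) / 2"] s(1) by auto
  have "prob (cylinder w \<inter> (shift ^^ p) -` cylinder [a]) \<le> (1 + s) / 2 * prob (cylinder w)"
    if "length w + N \<le> p" for w p a
  proof -
    have "prob (cylinder w) * prob (cylinder [a]) \<le> prob (cylinder w) * s"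
      by (intro mult_left_mono s) auto
    then have "prob (cylinder w \<inter> (shift ^^ p) -` cylinder [a])
        \<le> prob (cylinder w) * s + (1 - s) / 2 * prob (cylinder w)"
      using N[OF that, of "[a]"] by linarith
    then show ?thesis by (simp add: field_simps)
  qed
  then show ?thesis using s \<open>s \<ge> 0\<close> by (intro exI[of _ "(1 + s) / 2"] exI[of _ N]) auto
qed

text \<open>Cut \<open>v\<close> into blocks of length \<open>Suc N\<close> and keep only the last
  symbol of each. It comes after a gap of \<open>N\<close> symbols behind the word fixed so far, so
  each block costs a factor \<open>r\<close>. With \<open>w = []\<close> this is the uniform decay
  of cylinder measures.\<close>

lemma cylinder_append_small:
  assumes "\<epsilon> > 0"
  shows "\<exists>m. \<forall>w v. length v \<ge> m \<longrightarrow> prob (cylinder (w @ v)) \<le> \<epsilon> * prob (cylinder w)"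
proof -
  obtain r N where r: "0 \<le> r" "r < 1" and N: "\<And>w p a. length w + N \<le> p \<Longrightarrow>
     prob (cylinder w \<inter> (shift ^^ p) -` cylinder [a]) \<le> r * prob (cylinder w)"
    using far_symbol_bound by blast
  have *: "prob (cylinder (w @ v)) \<le> r ^ j * prob (cylinder w)" if "length v \<ge> j * Suc N" for j w v
    using that
  proof (induction j arbitrary: w v)
    case 0
    show ?case by (simp add: cylinder_append finite_measure_mono)
  next
    case (Suc j)
    define v1 v2 where "v1 = take (Suc N) v" and "v2 = drop (Suc N) v"
    have v: "v = v1 @ v2" and l1: "length v1 = Suc N" and l2: "length v2 \<ge> j * Suc N"
      using Suc.prems by (auto simp: v1_def v2_def)
    have "prob (cylinder (w @ v1)) \<le>
        prob (cylinder w \<inter> (shift ^^ (length w + N)) -` cylinder [v1 ! N])"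
    proof (rule finite_measure_mono)
      have "v1 ! N = y (length w + N)" if "\<forall>i<length v1. y (length w + i) = v1 ! i" for y
        using that l1 by simp
      then show "cylinder (w @ v1) \<subseteq> cylinder w \<inter> (shift ^^ (length w + N)) -` cylinder [v1 ! N]"
        unfolding cylinder_append by (auto simp: cylinder_def shift_funpow)
    qed auto
    also have "\<dots> \<le> r * prob (cylinder w)" by (rule N) simp
    finally have v1_le: "prob (cylinder (w @ v1)) \<le> r * prob (cylinder w)" .
    have "prob (cylinder ((w @ v1) @ v2)) \<le> r ^ j * prob (cylinder (w @ v1))"
      by (rule Suc.IH[OF l2])
    also have "\<dots> \<le> r ^ j * (r * prob (cylinder w))"
      using r v1_le by (intro mult_left_mono) auto
    finally show ?case using r by (simp add: v mult_ac)
  qed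
  obtain j where j: "r ^ j < \<epsilon>" using real_arch_pow_inv[OF assms r(2)] by blast
  have "prob (cylinder (w @ v)) \<le> \<epsilon> * prob (cylinder w)" if "length v \<ge> j * Suc N" for w v
    using *[OF that, of w] j mult_right_mono[of "r ^ j" \<epsilon> "prob (cylinder w)"] by simp
  then show ?thesis by blast
qed

section \<open>Return probabilities\<close>

lemma return_small:
  assumes "\<epsilon> > 0"
  shows "\<exists>m. \<forall>w k. length w \<ge> m \<longrightarrow> k \<ge> m \<longrightarrow>
    prob (cylinder w \<inter> (shift ^^ k) -` cylinder w) \<le> \<epsilon> * prob (cylinder w)"
proof -
  obtain m where m: "\<And>w v. length v \<ge> m \<Longrightarrow>
      prob (cylinder (w @ v)) \<le> \<epsilon> / 2 * prob (cylinder w)"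
    using cylinder_append_small[of "\<epsilon> / 2"] assms by auto
  obtain N where N: "\<And>w v p. length w + N \<le> p \<Longrightarrow>
    \<bar>prob (cylinder w \<inter> (shift ^^ p) -` cylinder v) - prob (cylinder w) * prob (cylinder v)\<bar>
      \<le> \<epsilon> / 2 * prob (cylinder w)"
    using cylinder_mixing[of "\<epsilon> / 2"] assms by auto
  have "prob (cylinder w \<inter> (shift ^^ k) -` cylinder w) \<le> \<epsilon> * prob (cylinder w)"
    if w: "length w \<ge> m + N" and k: "k \<ge> m + N" for w k
  proof (cases "k \<le> length w")
    case True
    \<comment> \<open>The second copy of \<open>w\<close> starts no later than the end of the first,
      and it prescribes the \<open>k\<close> symbols that follow the first: they are the last
      \<open>k\<close> symbols of \<open>w\<close>.\<close>
    have "prob (cylinder w \<inter> (shift ^^ k) -` cylinder w)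
        \<le> prob (cylinder (w @ drop (length w - k) w))"
    proof (rule finite_measure_mono)
      have "y (length w + i) = drop (length w - k) w ! i"
        if "\<forall>i<length w. y (k + i) = w ! i" "i < k" for y i
        using that(1)[rule_format, of "length w - k + i"] that(2) True by simp
      then show "cylinder w \<inter> (shift ^^ k) -` cylinder w
          \<subseteq> cylinder (w @ drop (length w - k) w)"
        unfolding cylinder_append using True by (auto simp: cylinder_def shift_funpow)
    qed auto
    also have "\<dots> \<le> \<epsilon> / 2 * prob (cylinder w)" by (rule m) (use True k in auto)
    also have "\<dots> \<le> \<epsilon> * prob (cylinder w)" using assms by (intro mult_right_mono) auto
    finally show ?thesis .
  next
    case False
    \<comment> \<open>Mixing needs a gap of \<open>N\<close>. Dropping the first \<open>N\<close>
      symbols of the second copy creates it, and at least \<open>m\<close> symbols remain.\<close>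
    let ?v = "drop N w"
    have "prob (cylinder w \<inter> (shift ^^ k) -` cylinder w)
        \<le> prob (cylinder w \<inter> (shift ^^ (k + N)) -` cylinder ?v)"
    proof (rule finite_measure_mono)
      have "y (k + N + i) = ?v ! i"
        if "\<forall>i<length w. y (k + i) = w ! i" "i < length w - N" for y i
        using that(1)[rule_format, of "N + i"] that(2) by (simp add: add.assoc)
      then show "cylinder w \<inter> (shift ^^ k) -` cylinder w
          \<subseteq> cylinder w \<inter> (shift ^^ (k + N)) -` cylinder ?v"
        by (auto simp: cylinder_def shift_funpow)
    qed auto
    also have "\<dots> \<le> prob (cylinder w) * prob (cylinder ?v) + \<epsilon> / 2 * prob (cylinder w)"
      using N[of w "k + N" ?v] False by linarith
    also have "prob (cylinder w) * prob (cylinder ?v) \<le> prob (cylinder w) * (\<epsilon> / 2)"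
      using m[of ?v "[]"] w prob_space by (intro mult_left_mono) auto
    finally show ?thesis by (simp add: field_simps)
  qed
  then show ?thesis by blast
qed

text \<open>The left side telescopes into \<open>j\<close> decrements, each at most the first one,
  which is the bracket on the right.\<close>

lemma periodic_visits_decay:
  fixes k :: nat
  assumes A [measurable]: "A \<in> sets \<mu>"
  defines "W j \<equiv> {y. \<forall>i\<le>j. (shift ^^ (i * k)) y \<in> A}"
  shows "prob A - prob (W j) \<le> real j * (prob A - prob (A \<inter> (shift ^^ k) -` A))"
proof -
  have W_eq: "W j = (\<Inter>i\<in>{..j}. (shift ^^ (i * k)) -` A)" for j by (auto simp: W_def)
  have [measurable]: "W j \<in> sets \<mu>" for j
    unfolding W_eq by (intro sets.finite_INT) auto
  have mono: "W (Suc j) \<subseteq> W j" for j by (auto simp: W_def)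
  have dec: "prob (W j - W (Suc j)) = prob (W j) - prob (W (Suc j))" for j
    by (rule finite_measure_Diff) (auto simp: mono)
  have W0: "W 0 = A" by (auto simp: W_def)
  have W1: "W (Suc 0) = A \<inter> (shift ^^ k) -` A" by (auto simp: W_def le_Suc_eq)
  have step: "prob (W (Suc j) - W (Suc (Suc j))) \<le> prob (W j - W (Suc j))" for j
  proof -
    have shifted: "(shift ^^ (i * k)) ((shift ^^ k) y) = (shift ^^ (Suc i * k)) y" for i y
      by (simp add: funpow_add add.commute[of k])
    \<comment> \<open>Forget the visit at time 0 and shift by \<open>k\<close>: a first miss at time
      \<open>(j + 2) * k\<close> becomes a first miss at time \<open>(j + 1) * k\<close>. Invariance
      then compares the probabilities.\<close>
    have "W (Suc j) - W (Suc (Suc j)) \<subseteq> (shift ^^ k) -` (W j - W (Suc j))"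
    proof
      fix y assume y: "y \<in> W (Suc j) - W (Suc (Suc j))"
      then have "(shift ^^ k) y \<in> W j"
        unfolding W_def by (auto simp only: shifted Suc_le_mono mem_Collect_eq)
      moreover have "(shift ^^ (Suc (Suc j) * k)) y \<notin> A"
        using y unfolding W_def by (auto simp: le_Suc_eq)
      then have "(shift ^^ k) y \<notin> W (Suc j)"
        unfolding W_def using shifted[of "Suc j" y] by auto
      ultimately show "y \<in> (shift ^^ k) -` (W j - W (Suc j))" by simp
    qed
    then have "prob (W (Suc j) - W (Suc (Suc j))) \<le> prob ((shift ^^ k) -` (W j - W (Suc j)))"
      by (intro finite_measure_mono) auto
    then show ?thesis by (simp add: prob_vimage_shift)
  qed
  have first: "prob (W j - W (Suc j)) \<le> prob (W 0 - W (Suc 0))" for j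
    by (induction j) (use step order_trans in blast)+
  show ?thesis
  proof (induction j)
    case (Suc j)
    have "prob (W j) - prob (W (Suc j)) \<le> prob A - prob (A \<inter> (shift ^^ k) -` A)"
      using first[of j] unfolding dec by (simp add: W0 W1)
    then show ?case using Suc by (simp add: algebra_simps)
  qed (simp add: W0)
qed

text \<open>However short \<open>k\<close> is, \<open>J\<close> further visits reach beyond the
  mixing gap, so making all of them has probability at most \<open>r * prob (cylinder w)\<close>.
  This loss is spread over \<open>J\<close> decrements, and the first, being the largest, is at
  least their average.\<close>

lemma return_bounded_away:
  "\<exists>\<delta>>0. \<forall>w k. w \<noteq> [] \<longrightarrow> k \<ge> 1 \<longrightarrow>
    prob (cylinder w \<inter> (shift ^^ k) -` cylinder w) \<le> (1 - \<delta>) * prob (cylinder w)"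
proof -
  obtain r N where r: "0 \<le> r" "r < 1" and N: "\<And>w p a. length w + N \<le> p \<Longrightarrow>
     prob (cylinder w \<inter> (shift ^^ p) -` cylinder [a]) \<le> r * prob (cylinder w)"
    using far_symbol_bound by blast
  \<comment> \<open>Since \<open>k \<ge> 1\<close>, \<open>J * k \<ge> Suc N\<close>; the extra one
    makes up for the \<open>- 1\<close> in \<open>?p\<close>, so that
    \<open>?p \<ge> length w + N\<close>. At \<open>?p\<close> stands the last symbol of the copy of
    \<open>w\<close> started at time \<open>J * k\<close>; only this symbol is kept, as that copy
    may overlap the first.\<close>
  define J where "J = Suc N"
  have "prob (cylinder w \<inter> (shift ^^ k) -` cylinder w) \<le> (1 - (1 - r) / J) * prob (cylinder w)"
    if w: "w \<noteq> []" and k: "k \<ge> 1" for w k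
  proof -
    let ?A = "cylinder w"
    let ?W = "{y. \<forall>i\<le>J. (shift ^^ (i * k)) y \<in> ?A}"
    let ?p = "J * k + (length w - 1)"
    have Jk: "Suc N \<le> J * k" using mult_le_mono2[OF k, of J] by (simp add: J_def)
    have "?W \<subseteq> ?A \<inter> (shift ^^ ?p) -` cylinder [last w]"
    proof
      fix y assume y: "y \<in> ?W"
      then have "y \<in> ?A" using spec[of _ 0] by fastforce
      moreover have "(shift ^^ (J * k)) y \<in> ?A" using y by simp
      then have "y ?p = last w"
        using w by (simp add: cylinder_def shift_funpow last_conv_nth)
      ultimately show "y \<in> ?A \<inter> (shift ^^ ?p) -` cylinder [last w]"
        by (simp add: cylinder_def shift_funpow)
    qed
    then have "prob ?W \<le> prob (?A \<inter> (shift ^^ ?p) -` cylinder [last w])"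
      by (intro finite_measure_mono) auto
    also have "\<dots> \<le> r * prob ?A" by (rule N) (use Jk w in \<open>cases w; auto\<close>)
    finally have "prob ?A - r * prob ?A \<le> J * (prob ?A - prob (?A \<inter> (shift ^^ k) -` ?A))"
      using periodic_visits_decay[where A = ?A and k = k and j = J] by simp
    then show ?thesis by (simp add: J_def field_simps)
  qed
  moreover have "(1 - r) / J > 0" using r by (simp add: J_def)
  ultimately show ?thesis by blast
qed

section \<open>The potential well and the shortest return\<close>

text \<open>Returns before the shortest return time have probability zero, so up to a null set only
  the return at \<open>k\<close> itself takes points out of the well. That this return has positive
  probability is recorded because it later excludes small \<open>k\<close> at nonperiodic
  points.\<close>

lemma potential_well_ge:
  assumes pos: "prob (cylinder w) > 0"
  shows "\<exists>k\<ge>1. prob (cylinder w \<inter> (shift ^^ k) -` cylinder w) > 0 \<and>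
    potential_well \<mu> (cylinder w)
      \<ge> 1 - prob (cylinder w \<inter> (shift ^^ k) -` cylinder w) / prob (cylinder w)"
proof -
  let ?A = "cylinder w"
  let ?R = "\<lambda>k. ?A \<inter> (shift ^^ k) -` ?A"
  define S where "S = {k. 1 \<le> k \<and> prob (?R k) > 0}"
  have cond: "measure (uniform_measure \<mu> ?A) B = prob (?A \<inter> B) / prob ?A" if "B \<in> sets \<mu>" for B
    by (rule measure_uniform_measure) (use pos that in \<open>auto simp: emeasure_eq_measure\<close>)
  have ret: "shortest_return \<mu> ?A = Inf (enat ` S)"
    using pos by (simp add: shortest_return_def S_def cond zero_less_divide_iff)
  \<comment> \<open>The infimum over the empty set would be \<infinity>. Mixing with error
    \<open>prob ?A / 2\<close> keeps \<open>prob (?R p)\<close> at least half the square of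
    \<open>prob ?A\<close> for distant \<open>p\<close>.\<close>
  have "S \<noteq> {}"
  proof -
    obtain N where N: "\<And>p. length w + N \<le> p \<Longrightarrow>
        \<bar>prob (?R p) - prob ?A * prob ?A\<bar> \<le> prob ?A / 2 * prob ?A"
      using cylinder_mixing[of "prob ?A / 2"] pos by auto
    define p where "p = Suc (length w + N)"
    have "prob ?A * prob ?A > 0" using pos by simp
    moreover have "\<bar>prob (?R p) - prob ?A * prob ?A\<bar> \<le> (prob ?A * prob ?A) / 2"
      using N[of p] by (simp add: p_def)
    ultimately have "prob (?R p) > 0" by linarith
    then have "p \<in> S" by (simp add: S_def p_def)
    then show ?thesis by blast
  qed
  define k where "k = (LEAST k. k \<in> S)"
  have k: "k \<in> S" unfolding k_def using \<open>S \<noteq> {}\<close> by (auto intro: LeastI)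
  have le: "k \<le> i" if "i \<in> S" for i unfolding k_def using that by (rule Least_le)
  have tau: "shortest_return \<mu> ?A = enat k"
    unfolding ret by (rule antisym) (use k le in \<open>auto intro: Inf_lower Inf_greatest\<close>)
  \<comment> \<open>Expressing the event by finitely many visits makes it measurable, as the
    quotient formula \<open>cond\<close> requires.\<close>
  have hit: "{y. hitting_time ?A y > enat k} = UNIV - (\<Union>i\<in>{1..k}. (shift ^^ i) -` ?A)" (is "?H = _")
  proof -
    have "hitting_time ?A y > enat k \<longleftrightarrow> (\<forall>i\<in>{1..k}. (shift ^^ i) y \<notin> ?A)" for y
    proof
      assume L: "hitting_time ?A y > enat k"
      show "\<forall>i\<in>{1..k}. (shift ^^ i) y \<notin> ?A"
      proof (intro ballI notI)
        fix i assume "i \<in> {1..k}" "(shift ^^ i) y \<in> ?A"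
        then have "hitting_time ?A y \<le> enat i"
          unfolding hitting_time_def by (intro Inf_lower) auto
        then show False using L \<open>i \<in> {1..k}\<close> by (metis atLeastAtMost_iff enat_ord_simps(1) leD order_trans)
      qed
    next
      assume R: "\<forall>i\<in>{1..k}. (shift ^^ i) y \<notin> ?A"
      have "enat (Suc k) \<le> hitting_time ?A y"
        unfolding hitting_time_def by (rule Inf_greatest) (use R in \<open>force simp: not_less_eq_eq[symmetric]\<close>)
      then show "hitting_time ?A y > enat k"
        by (metis enat_ord_simps(2) lessI order.strict_trans2)
    qed
    then show ?thesis by auto
  qed
  have H [measurable]: "?H \<in> sets \<mu>"
    unfolding hit using sets.compl_sets[of "\<Union>i\<in>{1..k}. (shift ^^ i) -` ?A" \<mu>] by simp
  have early: "prob (?R i) = 0" if "i \<in> {1..<k}" for i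
    using le[of i] that by (auto simp: S_def zero_less_measure_iff)
  have "prob (\<Union>i\<in>{1..<k}. ?R i) \<le> (\<Sum>i\<in>{1..<k}. prob (?R i))"
    by (rule finite_measure_subadditive_finite) auto
  also have "\<dots> = 0" using early by simp
  finally have null: "prob (\<Union>i\<in>{1..<k}. ?R i) = 0" by (simp add: measure_le_0_iff)
  have "?A \<subseteq> ((?A \<inter> ?H) \<union> ?R k) \<union> (\<Union>i\<in>{1..<k}. ?R i)"
    unfolding hit by (auto simp: le_less)
  then have "prob ?A \<le> prob (((?A \<inter> ?H) \<union> ?R k) \<union> (\<Union>i\<in>{1..<k}. ?R i))"
    by (rule finite_measure_mono) auto
  also have "\<dots> \<le> prob ((?A \<inter> ?H) \<union> ?R k) + prob (\<Union>i\<in>{1..<k}. ?R i)"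
    by (rule measure_Un_le) auto
  also have "prob ((?A \<inter> ?H) \<union> ?R k) \<le> prob (?A \<inter> ?H) + prob (?R k)"
    by (rule measure_Un_le) auto
  finally have "prob ?A - prob (?R k) \<le> prob (?A \<inter> ?H)" using null by simp
  moreover have "potential_well \<mu> ?A = prob (?A \<inter> ?H) / prob ?A"
    unfolding potential_well_def tau by (rule cond) (rule H)
  ultimately have "potential_well \<mu> ?A \<ge> 1 - prob (?R k) / prob ?A"
    using pos by (simp add: field_simps)
  then show ?thesis using k by (auto simp: S_def)
qed

lemma potential_well_le_1: "prob (cylinder w) > 0 \<Longrightarrow> potential_well \<mu> (cylinder w) \<le> 1"
  unfolding potential_well_def
  by (intro prob_space.prob_le_1 prob_space_uniform_measure) (auto simp: emeasure_eq_measure)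

section \<open>Almost sure properties of points\<close>

lemma AE_prefix_pos: "AE x in \<mu>. \<forall>n. prob (cylinder (prefix_of x n)) > 0"
proof -
  have "AE x in \<mu>. x \<in> cylinder w \<longrightarrow> prob (cylinder w) > 0" for w
  proof (cases "prob (cylinder w) = 0")
    case True
    then have "cylinder w \<in> null_sets \<mu>" by (auto simp: emeasure_eq_measure)
    then show ?thesis using AE_not_in by fastforce
  qed (simp add: zero_less_measure_iff)
  \<comment> \<open>There are only countably many words, so the exceptional null sets can be
    united.\<close>
  then have "AE x in \<mu>. \<forall>w. x \<in> cylinder w \<longrightarrow> prob (cylinder w) > 0"
    by (simp add: AE_all_countable)
  then show ?thesis by eventually_elim (auto simp: in_cylinder_prefix_of)
qed

text \<open>A single point is the intersection of its prefix cylinders, whose probabilities tend to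
  0.\<close>

lemma AE_neq: "AE y in \<mu>. y \<noteq> x"
proof -
  let ?I = "\<Inter>n. cylinder (prefix_of x n)"
  have "prob ?I \<le> \<epsilon>" if "\<epsilon> > 0" for \<epsilon>
  proof -
    obtain m where "\<And>w v. length v \<ge> m \<Longrightarrow> prob (cylinder (w @ v)) \<le> \<epsilon> * prob (cylinder w)"
      using cylinder_append_small[OF \<open>\<epsilon> > 0\<close>] by blast
    \<comment> \<open>Here the prefix is the appended word \<open>v\<close>, and \<open>w\<close> is
      empty.\<close>
    from this[of "prefix_of x m" "[]"] have "prob (cylinder (prefix_of x m)) \<le> \<epsilon>"
      using prob_space by simp
    moreover have "prob ?I \<le> prob (cylinder (prefix_of x m))"
      by (rule finite_measure_mono) auto
    ultimately show ?thesis by simp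
  qed
  then have "prob ?I \<le> 0" by (metis dense not_less)
  moreover have "?I \<in> sets \<mu>" by measurable
  ultimately have "?I \<in> null_sets \<mu>"
    by (intro null_setsI) (simp_all add: emeasure_eq_measure measure_le_0_iff)
  then show ?thesis by (rule AE_I') (auto simp: in_cylinder_prefix_of)
qed

text \<open>For each \<open>k\<close> the sequences of period \<open>k\<close> form a countable set,
  and every point is null.\<close>

lemma AE_not_periodic: "AE x in \<mu>. \<forall>k>0. \<exists>i. x (k + i) \<noteq> x i"
proof -
  have "AE x in \<mu>. k > 0 \<longrightarrow> (\<exists>i. x (k + i) \<noteq> x i)" for k
  proof (cases "k > 0")
    case True
    have "AE x in \<mu>. \<forall>y\<in>{y. \<forall>i. y (k + i) = y i}. x \<noteq> y"
      by (subst AE_ball_countable[OF countable_periodic[OF True]]) (intro ballI AE_neq)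
    then show ?thesis by eventually_elim auto
  qed simp
  then show ?thesis by (simp add: AE_all_countable)
qed

section \<open>Convergence and uniform lower bound of the potential well\<close>

text \<open>A possible return at time \<open>k\<close> makes the prefix agree with its own shift by
  \<open>k\<close>. At a nonperiodic point this fails somewhere, so long prefixes exclude every
  \<open>k < m\<close>, and \<open>return_small\<close> treats the others.\<close>

lemma potential_well_tendsto:
  assumes pos: "\<And>n. prob (cylinder (prefix_of x n)) > 0"
    and aperiodic: "\<And>k. k > 0 \<Longrightarrow> \<exists>i. x (k + i) \<noteq> x i"
  shows "(\<lambda>n. potential_well \<mu> (cylinder (prefix_of x n))) \<longlonglongrightarrow> 1"
proof (rule LIMSEQ_I)
  fix \<epsilon> :: real assume "\<epsilon> > 0"
  then obtain m where m: "\<And>w k. length w \<ge> m \<Longrightarrow> k \<ge> m \<Longrightarrow>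
      prob (cylinder w \<inter> (shift ^^ k) -` cylinder w) \<le> \<epsilon> / 2 * prob (cylinder w)"
    using return_small[of "\<epsilon> / 2"] by auto
  obtain f where f: "\<And>k. k > 0 \<Longrightarrow> x (k + f k) \<noteq> x (f k)" using aperiodic by metis
  \<comment> \<open>The sum dominates each \<open>k + f k\<close> with \<open>k < m\<close>; the
    summand \<open>m\<close> supplies the word length that \<open>return_small\<close> asks
    for.\<close>
  define n0 where "n0 = m + Suc (\<Sum>k<m. k + f k)"
  have "norm (potential_well \<mu> (cylinder (prefix_of x n)) - 1) < \<epsilon>" if n: "n \<ge> n0" for n
  proof -
    let ?A = "cylinder (prefix_of x n)"
    obtain k where k: "k \<ge> 1" "prob (?A \<inter> (shift ^^ k) -` ?A) > 0"
      and ge: "potential_well \<mu> ?A \<ge> 1 - prob (?A \<inter> (shift ^^ k) -` ?A) / prob ?A"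
      using potential_well_ge[OF pos] by blast
    have "k \<ge> m"
    proof (rule ccontr)
      assume "\<not> k \<ge> m"
      then have "k + f k \<le> (\<Sum>k<m. k + f k)" by (intro member_le_sum) auto
      then have kf: "k + f k < n" using n by (simp add: n0_def)
      \<comment> \<open>Positive probability yields a common point, and one such point already
        contradicts the mismatch at \<open>f k\<close>.\<close>
      obtain y where y: "y \<in> ?A" "(shift ^^ k) y \<in> ?A" using k(2)
        by (cases "?A \<inter> (shift ^^ k) -` ?A = {}") auto
      have "y (k + f k) = x (k + f k)" "y (k + f k) = x (f k)"
        using y kf by (auto simp: cylinder_def shift_funpow)
      then show False using f[of k] k(1) by simp
    qed
    then have "prob (?A \<inter> (shift ^^ k) -` ?A) \<le> \<epsilon> / 2 * prob ?A"
      using n by (intro m) (auto simp: n0_def)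
    then have "prob (?A \<inter> (shift ^^ k) -` ?A) / prob ?A \<le> \<epsilon> / 2"
      using pos[of n] by (simp add: field_simps)
    then show ?thesis
      using ge potential_well_le_1[OF pos, of n] \<open>\<epsilon> > 0\<close> by simp
  qed
  then show "\<exists>n0. \<forall>n\<ge>n0. norm (potential_well \<mu> (cylinder (prefix_of x n)) - 1) < \<epsilon>" by blast
qed

lemma potential_well_bounded_below:
  "\<exists>\<delta>>0. \<forall>w. w \<noteq> [] \<longrightarrow> prob (cylinder w) > 0 \<longrightarrow> potential_well \<mu> (cylinder w) \<ge> \<delta>"
proof -
  obtain \<delta> where "\<delta> > 0" and \<delta>: "\<And>w k. w \<noteq> [] \<Longrightarrow> k \<ge> 1 \<Longrightarrow>
    prob (cylinder w \<inter> (shift ^^ k) -` cylinder w) \<le> (1 - \<delta>) * prob (cylinder w)"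
    using return_bounded_away by blast
  have "potential_well \<mu> (cylinder w) \<ge> \<delta>" if w: "w \<noteq> []" and pos: "prob (cylinder w) > 0" for w
  proof -
    obtain k where k: "k \<ge> 1" and ge: "potential_well \<mu> (cylinder w)
        \<ge> 1 - prob (cylinder w \<inter> (shift ^^ k) -` cylinder w) / prob (cylinder w)"
      using potential_well_ge[OF pos] by blast
    have "prob (cylinder w \<inter> (shift ^^ k) -` cylinder w) / prob (cylinder w) \<le> 1 - \<delta>"
      using \<delta>[OF w k] pos by (simp add: pos_divide_le_eq)
    then show ?thesis using ge by simp
  qed
  then show ?thesis using \<open>\<delta> > 0\<close> by blast
qed

end

theorem theorem2:
  fixes \<mu> :: "(nat \<Rightarrow> 'a::countable) measure"
  assumes "prob_space \<mu>"
    and "sets \<mu> = sets seq_space"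
    and "stationary \<mu>"
    and "phi_mixing \<mu>"
    and "\<And>a. measure \<mu> (cylinder [a]) < 1"
  shows "(AE x in \<mu>. (\<lambda>n. potential_well \<mu> (cylinder (prefix_of x n))) \<longlonglongrightarrow> 1) \<and>
         (psi_mixing \<mu> \<or> summable_phi_mixing \<mu> \<longrightarrow>
          (\<exists>n1\<ge>1. Inf {potential_well \<mu> (cylinder w) | w.
                       length w \<ge> n1 \<and> measure \<mu> (cylinder w) > 0} > 0))"
proof -
  interpret phi_mixing_shift \<mu>
    using assms by (simp add: phi_mixing_shift_def phi_mixing_shift_axioms_def)
  have "AE x in \<mu>. (\<lambda>n. potential_well \<mu> (cylinder (prefix_of x n))) \<longlonglongrightarrow> 1"
    using AE_prefix_pos AE_not_periodic
    by eventually_elim (rule potential_well_tendsto; simp)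
  \<comment> \<open>The lower bound holds for all nonempty words, so \<open>n1 = 1\<close> can be
    taken.\<close>
  moreover have "Inf {potential_well \<mu> (cylinder w) | w.
      length w \<ge> 1 \<and> measure \<mu> (cylinder w) > 0} > 0"
  proof -
    let ?S = "{potential_well \<mu> (cylinder w) | w. length w \<ge> 1 \<and> measure \<mu> (cylinder w) > 0}"
    obtain \<delta> where "\<delta> > 0" and \<delta>: "\<And>w. w \<noteq> [] \<Longrightarrow> prob (cylinder w) > 0 \<Longrightarrow>
        potential_well \<mu> (cylinder w) \<ge> \<delta>"
      using potential_well_bounded_below by blast
    \<comment> \<open>For the real \<open>Inf\<close>, a common lower bound transfers only if
      \<open>?S\<close> is nonempty; a point whose prefixes all have positive probability supplies
      an element.\<close>
    obtain x where "prob (cylinder (prefix_of x 1)) > 0"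
      using eventually_happens'[OF ae_filter_bot AE_prefix_pos] by blast
    then have "potential_well \<mu> (cylinder (prefix_of x 1)) \<in> ?S"
      by (intro CollectI exI[of _ "prefix_of x 1"]) simp
    then have "?S \<noteq> {}" by blast
    then have "Inf ?S \<ge> \<delta>" by (rule cInf_greatest) (use \<delta> in \<open>fastforce simp: Suc_le_eq\<close>)
    with \<open>\<delta> > 0\<close> show ?thesis by (rule order.strict_trans2)
  qed
  then have "\<exists>n1\<ge>1. Inf {potential_well \<mu> (cylinder w) | w.
      length w \<ge> n1 \<and> measure \<mu> (cylinder w) > 0} > 0"
    by (intro exI[of _ 1] conjI order.refl)
  ultimately show ?thesis by (intro conjI impI)
qed

end
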